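(* Let $\Gamma_1$ be the graph with vertices $a,b,c,d,e$ and edges $\{a,d\},\{a,e\},\{b,e\},\{c,d\},\{d,e\}$, and let $\Gamma_2$ be the graph with vertices $a_1,a_2,b,c,d,e$ and edges $\{a_1,a_2\},\{a_1,c\},\{a_1,d\},\{a_1,e\},\{a_2,b\},\{a_2,d\},\{a_2,e\},\{b,e\},\{c,d\},\{d,e\}$. Then $\Gamma_1$ is not an induced subgraph of the extension graph $\Gamma_2^e$ of $\Gamma_2$.
   Context: Graphs are simple and undirected. For elements $g,h$ of a group, $[g,h]=g^{-1}h^{-1}gh$. For a graph $\Gamma$ with vertex set $V(\Gamma)$ and edge set $E$, the partially commutative group with commutation graph $\Gamma$ is $\mathbb{G}(\Gamma)=\langle V(\Gamma)\mid [x,y],\ \{x,y\}\in E\rangle$. The extension graph $\Gamma^e$ of $\Gamma$ is the (simple) graph with vertex set $\{g^{-1}xg\in\mathbb{G}(\Gamma)\mid x\in V(\Gamma),\ g\in\mathbb{G}(\Gamma)\}$ (a set of elements of $\mathbb{G}(\Gamma)$), with an edge joining distinct vertices $u$ and $v$ if and only if $[u,v]=1$ in $\mathbb{G}(\Gamma)$. A graph $\Lambda$ is called an induced subgraph of a graph $\Delta$ if $\Lambda$ is isomorphic to a full subgraph of $\Delta$ (i.e. the subgraph of $\Delta$ spanned by some set of vertices, with all edges of $\Delta$ between them). *)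

theory Defs
  imports "HOL-Algebra.Group"
begin

section \<open>Simple graphs and full subgraphs\<close>

text \<open>Graphs may be infinite; an edge is the two-element set of its end points.\<close>

record 'v sgraph =
  verts :: "'v set"
  edges :: "'v set set"

definition simple_graph :: "'v sgraph \<Rightarrow> bool" where
  "simple_graph G \<longleftrightarrow> edges G \<subseteq> {{u, v} | u v. u \<in> verts G \<and> v \<in> verts G \<and> u \<noteq> v}"

definition full_subgraph :: "'v sgraph \<Rightarrow> 'v set \<Rightarrow> 'v sgraph" where
  "full_subgraph G S = \<lparr>verts = S, edges = {E \<in> edges G. E \<subseteq> S}\<rparr>"

definition graph_iso :: "'v sgraph \<Rightarrow> 'w sgraph \<Rightarrow> bool" where
  "graph_iso G H \<longleftrightarrow>
     (\<exists>f. bij_betw f (verts G) (verts H) \<and>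
          (\<forall>u \<in> verts G. \<forall>v \<in> verts G. {u, v} \<in> edges G \<longleftrightarrow> {f u, f v} \<in> edges H))"

definition is_induced_subgraph :: "'v sgraph \<Rightarrow> 'w sgraph \<Rightarrow> bool" where
  "is_induced_subgraph L D \<longleftrightarrow> (\<exists>S \<subseteq> verts D. graph_iso L (full_subgraph D S))"

section \<open>Groups given by generators and relators\<close>

text \<open>
  A word is a list of letters, where \<open>(x, True)\<close> stands for the generator \<open>x\<close> and
  \<open>(x, False)\<close> for its formal inverse. The group with generating set \<open>X\<close> and set of
  relators \<open>R\<close> consists of the words over \<open>X\<close> modulo the smallest congruence that
  identifies with the empty word both \<open>x x\<^sup>-\<^sup>1\<close> and \<open>x\<^sup>-\<^sup>1 x\<close>, for \<open>x\<close> in \<open>X\<close>, and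
  every relator.
\<close>

type_synonym 'a word = "('a \<times> bool) list"

definition words :: "'a set \<Rightarrow> 'a word set" where
  "words X = lists (X \<times> UNIV)"

inductive word_equiv :: "'a set \<Rightarrow> 'a word set \<Rightarrow> 'a word \<Rightarrow> 'a word \<Rightarrow> bool"
  for X :: "'a set" and R :: "'a word set" where
  refl: "w \<in> words X \<Longrightarrow> word_equiv X R w w"
| sym: "word_equiv X R u v \<Longrightarrow> word_equiv X R v u"
| trans: "word_equiv X R u v \<Longrightarrow> word_equiv X R v w \<Longrightarrow> word_equiv X R u w"
| cancel: "u \<in> words X \<Longrightarrow> v \<in> words X \<Longrightarrow> x \<in> X \<Longrightarrow>
    word_equiv X R (u @ [(x, s), (x, \<not> s)] @ v) (u @ v)"
| relator: "u \<in> words X \<Longrightarrow> v \<in> words X \<Longrightarrow> r \<in> words X \<Longrightarrow> r \<in> R \<Longrightarrow>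
    word_equiv X R (u @ r @ v) (u @ v)"

definition word_class :: "'a set \<Rightarrow> 'a word set \<Rightarrow> 'a word \<Rightarrow> 'a word set" where
  "word_class X R w = {v. word_equiv X R w v}"

definition presented_group :: "'a set \<Rightarrow> 'a word set \<Rightarrow> 'a word set monoid" where
  "presented_group X R =
     \<lparr>carrier = word_class X R ` words X,
      monoid.mult = (\<lambda>A B. \<Union>u \<in> A. \<Union>v \<in> B. word_class X R (u @ v)),
      one = word_class X R []\<rparr>"

definition generator :: "'a set \<Rightarrow> 'a word set \<Rightarrow> 'a \<Rightarrow> 'a word set" where
  "generator X R x = word_class X R [(x, True)]"

lemma words_append [simp]: "u @ v \<in> words X \<longleftrightarrow> u \<in> words X \<and> v \<in> words X"
  by (auto simp: words_def)

lemma words_Nil [simp]: "[] \<in> words X"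
  by (simp add: words_def)

lemma words_Cons [simp]: "(x, s) # w \<in> words X \<longleftrightarrow> x \<in> X \<and> w \<in> words X"
  by (auto simp: words_def)

lemma word_equiv_words:
  "word_equiv X R u v \<Longrightarrow> u \<in> words X \<and> v \<in> words X"
  by (induction rule: word_equiv.induct) auto

lemma word_equiv_append_left:
  "word_equiv X R u v \<Longrightarrow> p \<in> words X \<Longrightarrow> word_equiv X R (p @ u) (p @ v)"
proof (induction rule: word_equiv.induct)
  case (cancel u v x s)
  then show ?case using word_equiv.cancel[of "p @ u" X v x R s] by simp
next
  case (relator u v r)
  then show ?case using word_equiv.relator[of "p @ u" X v r R] by simp
next
  case (refl w)
  then show ?case by (intro word_equiv.refl) simp
next
  case (sym u v)
  then show ?case by (blast intro: word_equiv.sym)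
next
  case (trans u v w)
  then show ?case using word_equiv.trans by metis
qed

lemma word_equiv_append_right:
  "word_equiv X R u v \<Longrightarrow> q \<in> words X \<Longrightarrow> word_equiv X R (u @ q) (v @ q)"
proof (induction rule: word_equiv.induct)
  case (cancel u v x s)
  then show ?case using word_equiv.cancel[of u X "v @ q" x R s] by simp
next
  case (relator u v r)
  then show ?case using word_equiv.relator[of u X "v @ q" r R] by simp
next
  case (refl w)
  then show ?case by (intro word_equiv.refl) simp
next
  case (sym u v)
  then show ?case by (blast intro: word_equiv.sym)
next
  case (trans u v w)
  then show ?case using word_equiv.trans by metis
qed

lemma word_equiv_append:
  assumes "word_equiv X R u u'" "word_equiv X R v v'"
  shows "word_equiv X R (u @ v) (u' @ v')"
proof (rule word_equiv.trans)
  show "word_equiv X R (u @ v) (u' @ v)"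
    using assms word_equiv_words by (intro word_equiv_append_right) auto
  show "word_equiv X R (u' @ v) (u' @ v')"
    using assms word_equiv_words by (intro word_equiv_append_left) auto
qed

lemma word_class_eq_iff:
  assumes "u \<in> words X"
  shows "word_class X R u = word_class X R v \<longleftrightarrow> word_equiv X R u v"
proof
  assume eq: "word_class X R u = word_class X R v"
  have "u \<in> word_class X R u"
    using assms by (simp add: word_class_def word_equiv.refl)
  then have "word_equiv X R v u"
    unfolding eq by (simp add: word_class_def)
  then show "word_equiv X R u v" by (rule word_equiv.sym)
next
  assume uv: "word_equiv X R u v"
  have "word_equiv X R u w \<longleftrightarrow> word_equiv X R v w" for w
    using word_equiv.trans[OF uv] word_equiv.trans[OF word_equiv.sym[OF uv]] by iprover
  then show "word_class X R u = word_class X R v"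
    by (simp add: word_class_def)
qed

lemma presented_group_mult:
  assumes "u \<in> words X" "v \<in> words X"
  shows "word_class X R u \<otimes>\<^bsub>presented_group X R\<^esub> word_class X R v = word_class X R (u @ v)"
proof -
  let ?A = "word_class X R u" and ?B = "word_class X R v" and ?C = "word_class X R (u @ v)"
  have C: "word_class X R (u' @ v') = ?C" if "u' \<in> ?A" "v' \<in> ?B" for u' v'
  proof -
    have "word_equiv X R (u @ v) (u' @ v')"
      using that by (intro word_equiv_append) (simp_all add: word_class_def)
    then show ?thesis
      using word_class_eq_iff[of "u @ v" X R "u' @ v'"] assms by simp
  qed
  have "u \<in> ?A" "v \<in> ?B"
    using assms by (simp_all add: word_class_def word_equiv.refl)
  then have "?A \<noteq> {}" "?B \<noteq> {}" by blast+
  have "(\<Union>u' \<in> ?A. \<Union>v' \<in> ?B. word_class X R (u' @ v')) = (\<Union>u' \<in> ?A. \<Union>v' \<in> ?B. ?C)"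
    by (intro SUP_cong HOL.refl C)
  also have "\<dots> = ?C"
    using \<open>?A \<noteq> {}\<close> \<open>?B \<noteq> {}\<close> by simp
  finally show ?thesis
    by (simp add: presented_group_def)
qed

lemma word_inverse:
  "w \<in> words X \<Longrightarrow>
     rev (map (\<lambda>(x, s). (x, \<not> s)) w) \<in> words X \<and>
     word_equiv X R (rev (map (\<lambda>(x, s). (x, \<not> s)) w) @ w) []"
proof (induction w)
  case Nil
  then show ?case by (simp add: word_equiv.refl)
next
  case (Cons l w)
  obtain x s where l: "l = (x, s)" by (cases l)
  let ?i = "rev (map (\<lambda>(x, s). (x, \<not> s)) w)"
  have x: "x \<in> X" "w \<in> words X" using Cons.prems l by auto
  have "word_equiv X R (?i @ [(x, \<not> s), (x, \<not> \<not> s)] @ w) (?i @ w)"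
    using Cons.IH x by (intro word_equiv.cancel) auto
  then have "word_equiv X R (?i @ [(x, \<not> s), (x, \<not> \<not> s)] @ w) []"
    using Cons.IH[OF x(2)] by (blast intro: word_equiv.trans)
  then show ?case using Cons.IH[OF x(2)] x l by simp
qed

theorem presented_group_is_group: "group (presented_group X R)"
proof (rule groupI)
  fix A assume "A \<in> carrier (presented_group X R)"
  then obtain w where w: "w \<in> words X" "A = word_class X R w"
    by (auto simp: presented_group_def)
  let ?i = "rev (map (\<lambda>(x, s). (x, \<not> s)) w)"
  have i: "?i \<in> words X" "word_equiv X R (?i @ w) []"
    using word_inverse[OF w(1)] by auto
  have "word_class X R ?i \<otimes>\<^bsub>presented_group X R\<^esub> A = word_class X R []"
    using i w by (simp add: presented_group_mult word_class_eq_iff)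
  then show "\<exists>B \<in> carrier (presented_group X R).
      B \<otimes>\<^bsub>presented_group X R\<^esub> A = \<one>\<^bsub>presented_group X R\<^esub>"
    using i(1) by (auto simp: presented_group_def)
next
  fix A B
  assume "A \<in> carrier (presented_group X R)" "B \<in> carrier (presented_group X R)"
  then obtain u v where "u \<in> words X" "A = word_class X R u" "v \<in> words X" "B = word_class X R v"
    by (auto simp: presented_group_def)
  then have "A \<otimes>\<^bsub>presented_group X R\<^esub> B = word_class X R (u @ v)" "u @ v \<in> words X"
    by (auto simp: presented_group_mult)
  then show "A \<otimes>\<^bsub>presented_group X R\<^esub> B \<in> carrier (presented_group X R)"
    by (simp add: presented_group_def del: words_append)
next
  show "\<one>\<^bsub>presented_group X R\<^esub> \<in> carrier (presented_group X R)"
    by (simp add: presented_group_def)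
next
  fix A B C
  assume "A \<in> carrier (presented_group X R)" "B \<in> carrier (presented_group X R)"
    "C \<in> carrier (presented_group X R)"
  then obtain u v w where "u \<in> words X" "A = word_class X R u" "v \<in> words X" "B = word_class X R v"
    "w \<in> words X" "C = word_class X R w"
    by (auto simp: presented_group_def)
  then show "A \<otimes>\<^bsub>presented_group X R\<^esub> B \<otimes>\<^bsub>presented_group X R\<^esub> C =
      A \<otimes>\<^bsub>presented_group X R\<^esub> (B \<otimes>\<^bsub>presented_group X R\<^esub> C)"
    by (simp add: presented_group_mult)
next
  fix A assume "A \<in> carrier (presented_group X R)"
  then obtain w where "w \<in> words X" "A = word_class X R w"
    by (auto simp: presented_group_def)
  moreover have "\<one>\<^bsub>presented_group X R\<^esub> = word_class X R []"
    by (simp add: presented_group_def)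
  ultimately show "\<one>\<^bsub>presented_group X R\<^esub> \<otimes>\<^bsub>presented_group X R\<^esub> A = A"
    using presented_group_mult[of "[]" X w R] by simp
qed

section \<open>Partially commutative groups and extension graphs\<close>

definition commutator :: "('g, 'm) monoid_scheme \<Rightarrow> 'g \<Rightarrow> 'g \<Rightarrow> 'g" where
  "commutator G g h = inv\<^bsub>G\<^esub> g \<otimes>\<^bsub>G\<^esub> inv\<^bsub>G\<^esub> h \<otimes>\<^bsub>G\<^esub> g \<otimes>\<^bsub>G\<^esub> h"

text \<open>
  Each edge contributes the commutator relators for both orders of its end points. They are
  inverse to each other, so this does not affect the group.
\<close>

definition commutation_relators :: "'a sgraph \<Rightarrow> 'a word set" where
  "commutation_relators \<Gamma> =
     {[(x, False), (y, False), (x, True), (y, True)] | x y. {x, y} \<in> edges \<Gamma>}"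

definition pc_group :: "'a sgraph \<Rightarrow> 'a word set monoid" where
  "pc_group \<Gamma> = presented_group (verts \<Gamma>) (commutation_relators \<Gamma>)"

definition pc_gen :: "'a sgraph \<Rightarrow> 'a \<Rightarrow> 'a word set" where
  "pc_gen \<Gamma> x = generator (verts \<Gamma>) (commutation_relators \<Gamma>) x"

definition extension_graph :: "'a sgraph \<Rightarrow> 'a word set sgraph" where
  "extension_graph \<Gamma> =
     (let G = pc_group \<Gamma>;
          W = {inv\<^bsub>G\<^esub> g \<otimes>\<^bsub>G\<^esub> pc_gen \<Gamma> x \<otimes>\<^bsub>G\<^esub> g | x g. x \<in> verts \<Gamma> \<and> g \<in> carrier G}
      in \<lparr>verts = W,
          edges = {{u, v} | u v. u \<in> W \<and> v \<in> W \<and> u \<noteq> v \<and> commutator G u v = \<one>\<^bsub>G\<^esub>}\<rparr>)"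

lemma group_pc_group: "group (pc_group \<Gamma>)"
  unfolding pc_group_def by (rule presented_group_is_group)

lemma simple_graph_extension_graph: "simple_graph (extension_graph \<Gamma>)"
  unfolding simple_graph_def extension_graph_def Let_def sgraph.simps by blast

section \<open>The two graphs\<close>

datatype vertex = va | va1 | va2 | vb | vc | vd | ve

definition Gamma1 :: "vertex sgraph" where
  "Gamma1 = \<lparr>verts = {va, vb, vc, vd, ve},
             edges = {{va, vd}, {va, ve}, {vb, ve}, {vc, vd}, {vd, ve}}\<rparr>"

definition Gamma2 :: "vertex sgraph" where
  "Gamma2 = \<lparr>verts = {va1, va2, vb, vc, vd, ve},
             edges = {{va1, va2}, {va1, vc}, {va1, vd}, {va1, ve}, {va2, vb},
                      {va2, vd}, {va2, ve}, {vb, ve}, {vc, vd}, {vd, ve}}\<rparr>"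

lemma simple_graph_Gamma1: "simple_graph Gamma1"
  by (auto simp: simple_graph_def Gamma1_def)

lemma simple_graph_Gamma2: "simple_graph Gamma2"
  by (auto simp: simple_graph_def Gamma2_def)

end

theory Submission
  imports Defs "HOL-Algebra.Coset"
begin

text \<open>
  The centralizer of a generator \<open>x\<close> is generated by the star of \<open>x\<close>. Indeed, if \<open>K\<close> is generated
  by the other generators and \<open>L\<close> by those adjacent to \<open>x\<close>, the group is \<open>F(K/L) \<rtimes> K\<close>, where the
  coset \<open>k L\<close> stands for \<open>k x k\<^sup>-\<^sup>1\<close>, so it acts on the reduced words of the free group \<open>F(K/L)\<close>.
  With the retractions onto stars it follows that adjacent vertices of the extension graph are
  simultaneously conjugate to adjacent vertices \<open>x, y\<close> of the graph, and that they are twins (have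
  the same closed neighbourhood) if \<open>x\<close> and \<open>y\<close> are. Every triangle of \<open>\<Gamma>\<^sub>2\<close> contains the twins
  \<open>a\<^sub>1, d\<close> or \<open>a\<^sub>2, e\<close>, whereas no two vertices of the triangle \<open>a, d, e\<close> of \<open>\<Gamma>\<^sub>1\<close> are twins:
  \<open>c\<close> and \<open>b\<close> tell them apart.
\<close>

section \<open>Words and partially commutative groups\<close>

lemma (in group) commute_inv:
  assumes "x \<in> carrier G" "y \<in> carrier G" "x \<otimes> y = y \<otimes> x"
  shows "inv x \<otimes> y = y \<otimes> inv x"
proof -
  have "inv x \<otimes> y = inv x \<otimes> (y \<otimes> x) \<otimes> inv x"
    using assms(1,2) by (simp add: m_assoc)
  also have "\<dots> = y \<otimes> inv x"
    unfolding assms(3)[symmetric] using assms(1,2) by (simp add: m_assoc[symmetric])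
  finally show ?thesis .
qed

lemma (in group) commutator_eq_one_iff:
  assumes "x \<in> carrier G" "y \<in> carrier G"
  shows "commutator G x y = \<one> \<longleftrightarrow> x \<otimes> y = y \<otimes> x"
proof -
  have "commutator G x y = inv (y \<otimes> x) \<otimes> (x \<otimes> y)"
    using assms by (simp add: commutator_def inv_mult_group m_assoc)
  then show ?thesis
    using assms by (metis inv_equality inv_inv inv_closed l_inv m_closed)
qed

lemma words_filter:
  "w \<in> words X \<Longrightarrow> filter (\<lambda>(y, s). y \<in> S) w \<in> words (X \<inter> S)"
  by (auto simp: words_def)

lemma words_mono: "X \<subseteq> Y \<Longrightarrow> words X \<subseteq> words Y"
  by (auto simp: words_def)

text \<open>Each letter has exponent sum zero in a commutator relator and in a cancelling pair, so
  the sum is an invariant of the group element. It shows that generators are nontrivial.\<close>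

lemma exponent_sum_word_equiv:
  assumes "word_equiv X (commutation_relators \<Gamma>) u v"
  shows "(\<Sum>(y, s)\<leftarrow>u. if y = x then if s then 1 else -1 else 0 :: int) =
    (\<Sum>(y, s)\<leftarrow>v. if y = x then if s then 1 else -1 else 0)"
  using assms by induction (auto simp: commutation_relators_def)

locale pc_graph =
  fixes \<Gamma> :: "'a sgraph"
  assumes simple: "simple_graph \<Gamma>"
begin

sublocale group "pc_group \<Gamma>"
  by (rule group_pc_group)

abbreviation mult_pc (infixl "\<cdot>" 70) where
  "g \<cdot> h \<equiv> g \<otimes>\<^bsub>pc_group \<Gamma>\<^esub> h"

abbreviation inv_pc where
  "inv_pc g \<equiv> inv\<^bsub>pc_group \<Gamma>\<^esub> g"

abbreviation carrier_pc where
  "carrier_pc \<equiv> carrier (pc_group \<Gamma>)"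

abbreviation gen :: "'a \<Rightarrow> 'a word set" where
  "gen \<equiv> pc_gen \<Gamma>"

abbreviation cls :: "'a word \<Rightarrow> 'a word set" where
  "cls \<equiv> word_class (verts \<Gamma>) (commutation_relators \<Gamma>)"

text \<open>\<open>words S\<close> also contains inverse letters, so for
  \<open>S \<subseteq> verts \<Gamma>\<close> this is the subgroup generated by \<open>S\<close>, in
  a form suited to induction on words.\<close>

definition span :: "'a set \<Rightarrow> 'a word set set" where
  "span S = cls ` words S"

lemma gen_eq_cls: "gen x = cls [(x, True)]"
  by (simp add: pc_gen_def generator_def)

lemma carrier_eq_span: "carrier_pc = span (verts \<Gamma>)"
  by (simp add: pc_group_def presented_group_def span_def)

lemma one_eq_cls: "\<one>\<^bsub>pc_group \<Gamma>\<^esub> = cls []"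
  by (simp add: pc_group_def presented_group_def)

lemma cls_append:
  "u \<in> words (verts \<Gamma>) \<Longrightarrow> v \<in> words (verts \<Gamma>) \<Longrightarrow> cls (u @ v) = cls u \<cdot> cls v"
  by (simp add: pc_group_def presented_group_mult)

lemma cls_closed [simp]: "w \<in> words (verts \<Gamma>) \<Longrightarrow> cls w \<in> carrier_pc"
  by (auto simp: carrier_eq_span span_def)

lemma gen_closed [simp]: "x \<in> verts \<Gamma> \<Longrightarrow> gen x \<in> carrier_pc"
  by (simp add: gen_eq_cls)

lemma cls_Cons:
  "x \<in> verts \<Gamma> \<Longrightarrow> w \<in> words (verts \<Gamma>) \<Longrightarrow> cls ((x, s) # w) = cls [(x, s)] \<cdot> cls w"
  using cls_append[of "[(x, s)]" w] by simp

lemma inv_cls_letter: "x \<in> verts \<Gamma> \<Longrightarrow> inv_pc (cls [(x, s)]) = cls [(x, \<not> s)]"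
proof (rule inv_equality)
  assume x: "x \<in> verts \<Gamma>"
  have "word_equiv (verts \<Gamma>) (commutation_relators \<Gamma>) ([] @ [(x, \<not> s), (x, \<not> \<not> s)] @ []) ([] @ [])"
    using x by (intro word_equiv.cancel) auto
  then have "cls [(x, \<not> s), (x, s)] = cls []"
    using x by (simp add: word_class_eq_iff)
  then show "cls [(x, \<not> s)] \<cdot> cls [(x, s)] = \<one>\<^bsub>pc_group \<Gamma>\<^esub>"
    using x by (simp add: cls_Cons[of x "[(x, s)]"] one_eq_cls)
qed auto

lemma cls_letter_False: "x \<in> verts \<Gamma> \<Longrightarrow> cls [(x, False)] = inv_pc (gen x)"
  using inv_cls_letter[of x True] by (simp add: gen_eq_cls)

lemma edge_verts: "{x, y} \<in> edges \<Gamma> \<Longrightarrow> x \<in> verts \<Gamma> \<and> y \<in> verts \<Gamma> \<and> x \<noteq> y"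
  using simple by (fastforce simp: simple_graph_def doubleton_eq_iff)

lemma gen_commute:
  assumes "{x, y} \<in> edges \<Gamma>"
  shows "gen x \<cdot> gen y = gen y \<cdot> gen x"
proof -
  have xy: "x \<in> verts \<Gamma>" "y \<in> verts \<Gamma>"
    using edge_verts[OF assms] by auto
  let ?r = "[(x, False), (y, False), (x, True), (y, True)]"
  have "word_equiv (verts \<Gamma>) (commutation_relators \<Gamma>) ([] @ ?r @ []) ([] @ [])"
    using assms xy by (intro word_equiv.relator) (auto simp: commutation_relators_def)
  then have "cls ?r = cls []"
    using xy by (simp add: word_class_eq_iff)
  then have "commutator (pc_group \<Gamma>) (gen x) (gen y) = \<one>\<^bsub>pc_group \<Gamma>\<^esub>"
    using xy by (simp add: cls_Cons[of x "_ # _"] cls_Cons[of y "_ # _"] cls_letter_False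
        gen_eq_cls[symmetric] one_eq_cls commutator_def m_assoc)
  then show ?thesis
    using xy by (simp add: commutator_eq_one_iff)
qed

lemma span_mono: "S \<subseteq> T \<Longrightarrow> span S \<subseteq> span T"
  using words_mono unfolding span_def by blast

lemma span_closed: "S \<subseteq> verts \<Gamma> \<Longrightarrow> g \<in> span S \<Longrightarrow> g \<in> carrier_pc"
  using span_mono carrier_eq_span by blast

lemma span_mult:
  assumes "S \<subseteq> verts \<Gamma>" "g \<in> span S" "h \<in> span S"
  shows "g \<cdot> h \<in> span S"
proof -
  obtain u v where uv: "u \<in> words S" "v \<in> words S" "g = cls u" "h = cls v"
    using assms by (auto simp: span_def)
  then have "g \<cdot> h = cls (u @ v)"
    using words_mono[OF assms(1)] by (subst cls_append) auto
  then show ?thesis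
    using uv by (auto simp: span_def)
qed

lemma gen_in_span: "x \<in> S \<Longrightarrow> cls [(x, s)] \<in> span S"
  by (simp add: span_def)

lemma subgroup_span:
  assumes "S \<subseteq> verts \<Gamma>"
  shows "subgroup (span S) (pc_group \<Gamma>)"
proof
  show "span S \<subseteq> carrier_pc"
    using span_closed[OF assms] by blast
  show "\<one>\<^bsub>pc_group \<Gamma>\<^esub> \<in> span S"
    by (simp add: one_eq_cls span_def)
  fix g h assume g: "g \<in> span S"
  show "g \<cdot> h \<in> span S" if "h \<in> span S"
    using span_mult[OF assms g that] .
  obtain w where w: "w \<in> words S" "g = cls w"
    using g by (auto simp: span_def)
  have "inv_pc (cls w) \<in> span S"
    using w(1)
  proof (induction w)
    case Nil
    then show ?case by (metis one_eq_cls inv_one span_def image_eqI)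
  next
    case (Cons a w)
    obtain x s where a: "a = (x, s)" by (cases a)
    have x: "x \<in> S" "x \<in> verts \<Gamma>" "w \<in> words S" "w \<in> words (verts \<Gamma>)"
      using Cons.prems a assms words_mono[OF assms] by auto
    have "inv_pc (cls (a # w)) = inv_pc (cls w) \<cdot> cls [(x, \<not> s)]"
      using x a by (simp add: cls_Cons[of x w] inv_mult_group inv_cls_letter)
    then show ?case
      using Cons.IH x by (simp add: span_mult[OF assms] gen_in_span)
  qed
  then show "inv_pc g \<in> span S"
    using w by simp
qed

lemma commute_span:
  assumes "g \<in> carrier_pc" "S \<subseteq> verts \<Gamma>" "\<And>y. y \<in> S \<Longrightarrow> gen y \<cdot> g = g \<cdot> gen y" "h \<in> span S"
  shows "h \<cdot> g = g \<cdot> h"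
proof -
  obtain w where w: "w \<in> words S" "h = cls w"
    using assms by (auto simp: span_def)
  have "cls w \<cdot> g = g \<cdot> cls w"
    using w(1)
  proof (induction w)
    case Nil
    then show ?case using assms(1) by (simp add: one_eq_cls[symmetric])
  next
    case (Cons a w)
    obtain x s where a: "a = (x, s)" by (cases a)
    have x: "x \<in> S" "x \<in> verts \<Gamma>" "w \<in> words S" "w \<in> words (verts \<Gamma>)"
      using Cons.prems a assms words_mono[OF assms(2)] by auto
    have l: "cls [(x, s)] \<cdot> g = g \<cdot> cls [(x, s)]"
      using assms(1,3) x commute_inv[of "gen x" g]
      by (cases s) (simp_all add: cls_letter_False gen_eq_cls[symmetric])
    have "cls (a # w) \<cdot> g = cls [(x, s)] \<cdot> g \<cdot> cls w"
      using Cons.IH x a assms(1) by (simp add: cls_Cons[of x w] m_assoc)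
    also have "\<dots> = g \<cdot> cls (a # w)"
      unfolding l using x a assms(1) by (simp add: cls_Cons[of x w] m_assoc)
    finally show ?case .
  qed
  then show ?thesis using w by simp
qed

lemma gen_neq_one:
  assumes "x \<in> verts \<Gamma>"
  shows "gen x \<noteq> \<one>\<^bsub>pc_group \<Gamma>\<^esub>"
proof
  assume "gen x = \<one>\<^bsub>pc_group \<Gamma>\<^esub>"
  then have "word_equiv (verts \<Gamma>) (commutation_relators \<Gamma>) [(x, True)] []"
    using assms by (simp add: gen_eq_cls one_eq_cls word_class_eq_iff)
  from exponent_sum_word_equiv[OF this, of x] show False by simp
qed

section \<open>Retractions onto the subgroups spanned by generators\<close>

text \<open>The homomorphism that kills the generators outside \<open>S\<close>. The union over all
  representatives avoids a choice; by \<open>retract_cls\<close> it is a union of equal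
  classes.\<close>

definition retract :: "'a set \<Rightarrow> 'a word set \<Rightarrow> 'a word set" where
  "retract S A = (\<Union>u \<in> A. cls (filter (\<lambda>(y, s). y \<in> S) u))"

text \<open>Deleting letters leaves a commutator relator intact, reduces it to a cancelling pair, or
  empties it.\<close>

lemma word_equiv_filter:
  assumes "word_equiv (verts \<Gamma>) (commutation_relators \<Gamma>) u v"
  shows "word_equiv (verts \<Gamma>) (commutation_relators \<Gamma>)
    (filter (\<lambda>(y, s). y \<in> S) u) (filter (\<lambda>(y, s). y \<in> S) v)"
  using assms
proof induction
  case (refl w)
  then show ?case
    using words_filter[of w _ S] words_mono[of "verts \<Gamma> \<inter> S"] by (intro word_equiv.refl) auto
next
  case (sym u v)
  then show ?case by (blast intro: word_equiv.sym)
next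
  case (trans u v w)
  then show ?case by (blast intro: word_equiv.trans)
next
  case (cancel u v x s)
  have *: "filter (\<lambda>(y, s). y \<in> S) w \<in> words (verts \<Gamma>)" if "w \<in> words (verts \<Gamma>)" for w
    using words_filter[OF that] words_mono[of "verts \<Gamma> \<inter> S"] by auto
  show ?case
    using cancel * word_equiv.cancel[OF *[of u] *[of v], of x _ s]
    by (cases "x \<in> S") (auto intro!: word_equiv.refl)
next
  case (relator u v r)
  have *: "filter (\<lambda>(y, s). y \<in> S) w \<in> words (verts \<Gamma>)" if "w \<in> words (verts \<Gamma>)" for w
    using words_filter[OF that] words_mono[of "verts \<Gamma> \<inter> S"] by auto
  obtain x y where r: "r = [(x, False), (y, False), (x, True), (y, True)]" "{x, y} \<in> edges \<Gamma>"
    using relator.hyps by (auto simp: commutation_relators_def)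
  have xy: "x \<in> verts \<Gamma>" "y \<in> verts \<Gamma>"
    using edge_verts[OF r(2)] by auto
  show ?case
    using relator xy * r word_equiv.relator[OF *[of u] *[of v] relator.hyps(3,4)]
      word_equiv.cancel[OF *[of u] *[of v], of _ "commutation_relators \<Gamma>" False]
    by (cases "x \<in> S"; cases "y \<in> S") (auto intro!: word_equiv.refl)
qed

lemma retract_cls:
  assumes "w \<in> words (verts \<Gamma>)"
  shows "retract S (cls w) = cls (filter (\<lambda>(y, s). y \<in> S) w)"
proof -
  have "cls (filter (\<lambda>(y, s). y \<in> S) u) = cls (filter (\<lambda>(y, s). y \<in> S) w)" if "u \<in> cls w" for u
  proof -
    have "word_equiv (verts \<Gamma>) (commutation_relators \<Gamma>)
        (filter (\<lambda>(y, s). y \<in> S) w) (filter (\<lambda>(y, s). y \<in> S) u)"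
      using that by (intro word_equiv_filter) (simp add: word_class_def)
    then show ?thesis
      using word_equiv_words word_class_eq_iff by metis
  qed
  moreover have "w \<in> cls w"
    using assms by (simp add: word_class_def word_equiv.refl)
  ultimately show ?thesis
    unfolding retract_def by blast
qed

lemma retract_in_span: "g \<in> carrier_pc \<Longrightarrow> retract S g \<in> span (verts \<Gamma> \<inter> S)"
  unfolding carrier_eq_span span_def by (auto simp: retract_cls intro: words_filter imageI)

lemma retract_closed [simp]: "g \<in> carrier_pc \<Longrightarrow> retract S g \<in> carrier_pc"
  using retract_in_span span_closed[of "verts \<Gamma> \<inter> S"] by blast

lemma retract_hom: "retract S \<in> hom (pc_group \<Gamma>) (pc_group \<Gamma>)"
proof (rule homI)
  fix g h assume "g \<in> carrier_pc" "h \<in> carrier_pc"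
  then obtain u v where uv: "u \<in> words (verts \<Gamma>)" "v \<in> words (verts \<Gamma>)" "g = cls u" "h = cls v"
    by (auto simp: carrier_eq_span span_def)
  moreover have "filter (\<lambda>(y, s). y \<in> S) w \<in> words (verts \<Gamma>)" if "w \<in> words (verts \<Gamma>)" for w
    using words_filter[OF that] words_mono[of "verts \<Gamma> \<inter> S"] by auto
  ultimately show "retract S (g \<cdot> h) = retract S g \<cdot> retract S h"
    by (simp add: cls_append[symmetric] retract_cls)
qed simp

lemma retract_gen:
  "x \<in> verts \<Gamma> \<Longrightarrow> retract S (gen x) = (if x \<in> S then gen x else \<one>\<^bsub>pc_group \<Gamma>\<^esub>)"
  by (simp add: gen_eq_cls retract_cls one_eq_cls)

lemma retract_eq:
  assumes "S \<subseteq> verts \<Gamma>" "g \<in> span S"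
  shows "retract S g = g"
proof -
  obtain w where w: "w \<in> words S" "g = cls w"
    using assms by (auto simp: span_def)
  then have "filter (\<lambda>(y, s). y \<in> S) w = w"
    by (intro filter_True) (auto simp: words_def)
  then show ?thesis
    using w words_mono[OF assms(1)] by (auto simp: retract_cls)
qed

definition link :: "'a \<Rightarrow> 'a set" where
  "link y = {z. {y, z} \<in> edges \<Gamma>}"

lemma link_verts: "link y \<subseteq> verts \<Gamma>"
  using edge_verts by (auto simp: link_def)

end

section \<open>Centralizers of generators\<close>

locale pc_vertex = pc_graph \<Gamma> for \<Gamma> :: "'a sgraph" +
  fixes x :: 'a
  assumes x [simp]: "x \<in> verts \<Gamma>"
begin

definition K :: "'a word set set" where
  "K = span (verts \<Gamma> - {x})"

definition L :: "'a word set set" where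
  "L = span (link x)"

abbreviation lcoset (infixr "\<bullet>" 70) where
  "g \<bullet> C \<equiv> g <#\<^bsub>pc_group \<Gamma>\<^esub> C"

lemma K_subgroup: "subgroup K (pc_group \<Gamma>)"
  unfolding K_def by (rule subgroup_span) auto

lemma L_subgroup: "subgroup L (pc_group \<Gamma>)"
  unfolding L_def by (rule subgroup_span[OF link_verts])

lemma L_subset_K: "L \<subseteq> K"
  unfolding K_def L_def using edge_verts by (intro span_mono) (auto simp: link_def)

lemma K_closed: "k \<in> K \<Longrightarrow> k \<in> carrier_pc"
  using K_subgroup by (rule subgroup.mem_carrier)

lemma L_closed: "k \<in> L \<Longrightarrow> k \<in> carrier_pc"
  using L_subgroup by (rule subgroup.mem_carrier)

lemma lcoset_L_self: "g \<in> L \<Longrightarrow> g \<bullet> L = L"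
  by (simp add: L_closed L_subgroup coset_join3)

lemma lcoset_L_self_iff:
  assumes "g \<in> carrier_pc"
  shows "g \<bullet> L = L \<longleftrightarrow> g \<in> L"
proof
  assume "g \<bullet> L = L"
  moreover have "g \<cdot> \<one>\<^bsub>pc_group \<Gamma>\<^esub> \<in> g \<bullet> L"
    using subgroup.one_closed[OF L_subgroup] unfolding l_coset_def by blast
  ultimately show "g \<in> L" using assms by simp
qed (rule lcoset_L_self)

lemma lcoset_lcoset: "g \<in> carrier_pc \<Longrightarrow> h \<in> carrier_pc \<Longrightarrow> g \<bullet> h \<bullet> L = (g \<cdot> h) \<bullet> L"
  by (rule lcos_m_assoc) (use L_closed in auto)

lemma L_commute: "g \<in> L \<Longrightarrow> cls [(x, s)] \<cdot> g = g \<cdot> cls [(x, s)]"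
proof -
  assume g: "g \<in> L"
  have "g \<cdot> gen x = gen x \<cdot> g"
  proof (rule commute_span[OF _ link_verts _ g[unfolded L_def]])
    show "gen y \<cdot> gen x = gen x \<cdot> gen y" if "y \<in> link x" for y
      using that gen_commute[of x y] by (simp add: link_def)
  qed simp
  then show ?thesis
    using commute_inv[of "gen x" g] L_closed[OF g]
    by (cases s) (simp_all add: cls_letter_False gen_eq_cls[symmetric])
qed

section \<open>The action of words on the reduced words of \<open>F(K/L)\<close>\<close>

type_synonym 'b state = "('b word set set \<times> bool) list"

text \<open>Left multiplication by the letter of the coset \<open>L\<close>, which stands for
  \<open>x\<close> itself or its inverse, with free cancellation at the head.\<close>

definition push :: "bool \<Rightarrow> 'a state \<Rightarrow> 'a state" where
  "push s w = (if w \<noteq> [] \<and> hd w = (L, \<not> s) then tl w else (L, s) # w)"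

text \<open>Conjugation by \<open>g\<close>: it carries the letter of \<open>k L\<close> to that of
  \<open>g k L\<close>.\<close>

definition shift :: "'a word set \<Rightarrow> 'a state \<Rightarrow> 'a state" where
  "shift g w = map (\<lambda>(C, t). (g \<bullet> C, t)) w"

definition act :: "'a \<times> bool \<Rightarrow> 'a state \<Rightarrow> 'a state" where
  "act = (\<lambda>(y, s). if y = x then push s else shift (cls [(y, s)]))"

definition reduced :: "'a state \<Rightarrow> bool" where
  "reduced w \<longleftrightarrow> fst ` set w \<subseteq> (\<lambda>k. k \<bullet> L) ` K \<and>
     successively (\<lambda>(C, s) (D, t). C = D \<longrightarrow> s = t) w"

lemma reduced_Nil [simp]: "reduced []"
  by (simp add: reduced_def)

lemma L_letter: "L \<in> (\<lambda>k. k \<bullet> L) ` K"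
  using lcoset_L_self subgroup.one_closed[OF L_subgroup] L_subset_K by (metis image_eqI subsetD)

lemma reduced_letter: "reduced w \<Longrightarrow> (C, t) \<in> set w \<Longrightarrow> C \<in> (\<lambda>k. k \<bullet> L) ` K"
  by (simp add: reduced_def image_subset_iff) (metis fst_conv)

lemma reduced_push:
  assumes "reduced w"
  shows "reduced (push s w)"
proof (cases w)
  case Nil
  then show ?thesis using L_letter by (simp add: push_def reduced_def)
next
  case (Cons a w')
  then show ?thesis
    using assms L_letter by (cases a) (auto simp: push_def reduced_def successively_Cons)
qed

text \<open>If the first \<open>push\<close> deletes the head letter, reducedness keeps the new head
  from being \<open>(L, s)\<close>, so the second \<open>push\<close> restores the deleted letter
  instead of cancelling again.\<close>

lemma push_push:
  assumes "reduced w"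
  shows "push (\<not> s) (push s w) = w"
proof (cases "w \<noteq> [] \<and> hd w = (L, \<not> s)")
  case True
  then obtain w' where w: "w = (L, \<not> s) # w'" by (cases w) auto
  then have "w' = [] \<or> hd w' \<noteq> (L, s)"
    using assms by (cases w') (auto simp: reduced_def)
  then show ?thesis using w by (auto simp: push_def)
next
  case False
  then show ?thesis by (auto simp: push_def)
qed

lemma shift_shift:
  assumes "reduced w" "g \<in> carrier_pc" "h \<in> carrier_pc"
  shows "shift g (shift h w) = shift (g \<cdot> h) w"
proof -
  have "g \<bullet> h \<bullet> C = (g \<cdot> h) \<bullet> C" if C: "(C, t) \<in> set w" for C t
  proof -
    obtain k where "k \<in> K" "C = k \<bullet> L"
      using reduced_letter[OF assms(1) C] by blast
    then show ?thesis
      using assms(2,3) K_closed by (simp add: lcoset_lcoset m_assoc)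
  qed
  then show ?thesis by (auto simp: shift_def)
qed

lemma shift_one:
  assumes "reduced w"
  shows "shift \<one>\<^bsub>pc_group \<Gamma>\<^esub> w = w"
proof -
  have "\<one>\<^bsub>pc_group \<Gamma>\<^esub> \<bullet> C = C" if C: "(C, t) \<in> set w" for C t
  proof -
    obtain k where "k \<in> K" "C = k \<bullet> L"
      using reduced_letter[OF assms C] by blast
    then show ?thesis
      using K_closed by (simp add: lcoset_lcoset)
  qed
  then show ?thesis by (auto simp: shift_def intro!: map_idI)
qed

text \<open>Translation by \<open>k\<close> is undone by the inverse of \<open>k\<close>. Hence
  \<open>shift k\<close> creates no cancelling pairs.\<close>

lemma lcoset_cancel:
  assumes "k \<in> K" "C \<in> (\<lambda>k. k \<bullet> L) ` K" "D \<in> (\<lambda>k. k \<bullet> L) ` K"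
  shows "k \<bullet> C = k \<bullet> D \<longleftrightarrow> C = D"
proof
  have *: "inv_pc k \<bullet> k \<bullet> C = C" if C: "C \<in> (\<lambda>k. k \<bullet> L) ` K" for C
  proof -
    obtain h where h: "h \<in> K" "C = h \<bullet> L"
      using C by blast
    then have "inv_pc k \<cdot> (k \<cdot> h) = h"
      using K_closed[OF assms(1)] K_closed[of h] by (simp add: m_assoc[symmetric])
    then show ?thesis
      using h K_closed[OF assms(1)] K_closed[of h] by (simp add: lcoset_lcoset)
  qed
  assume "k \<bullet> C = k \<bullet> D"
  then show "C = D" using *[OF assms(2)] *[OF assms(3)] by metis
qed simp

lemma reduced_shift:
  assumes "reduced w" "k \<in> K"
  shows "reduced (shift k w)"
proof -
  have "k \<bullet> C \<in> (\<lambda>k. k \<bullet> L) ` K" if "C \<in> (\<lambda>k. k \<bullet> L) ` K" for C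
    using that assms(2) K_closed subgroup.m_closed[OF K_subgroup]
    by (auto simp: lcoset_lcoset)
  moreover have "successively (\<lambda>(C, s) (D, t). C = D \<longrightarrow> s = t) (shift k w)"
    using assms(1) unfolding reduced_def shift_def
    by (induction w rule: induct_list012) (auto simp: lcoset_cancel[OF assms(2)])
  moreover have "fst ` set (shift k w) = (\<lambda>C. k \<bullet> C) ` fst ` set w"
    unfolding shift_def by force
  ultimately show ?thesis
    using assms(1) unfolding reduced_def by (simp add: image_subset_iff)
qed

text \<open>Elements of \<open>L\<close> fix the coset \<open>L\<close>, the only letter that
  \<open>push\<close> tests for or adds. This realizes the relations between \<open>x\<close> and
  its neighbours.\<close>

lemma shift_push:
  assumes "reduced w" "g \<in> L"
  shows "shift g (push s w) = push s (shift g w)"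
proof (cases w)
  case Nil
  then show ?thesis using lcoset_L_self[OF assms(2)] by (simp add: push_def shift_def)
next
  case (Cons a w')
  obtain C t where a: "a = (C, t)" by (cases a)
  have "C \<in> (\<lambda>k. k \<bullet> L) ` K"
    using assms(1) Cons a by (auto simp: reduced_def)
  then have "g \<bullet> C = L \<longleftrightarrow> C = L"
    using lcoset_cancel[of g C L] L_letter L_subset_K lcoset_L_self[OF assms(2)] assms(2) by auto
  then show ?thesis
    using lcoset_L_self[OF assms(2)] Cons a by (simp add: push_def shift_def)
qed

lemma cls_letter_in_K: "y \<in> verts \<Gamma> \<Longrightarrow> y \<noteq> x \<Longrightarrow> cls [(y, s)] \<in> K"
  unfolding K_def by (rule gen_in_span) simp

lemma cls_letter_in_L: "{x, y} \<in> edges \<Gamma> \<Longrightarrow> cls [(y, s)] \<in> L"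
  unfolding L_def by (rule gen_in_span) (simp add: link_def)

lemma reduced_act: "reduced w \<Longrightarrow> y \<in> verts \<Gamma> \<Longrightarrow> reduced (act (y, s) w)"
  by (simp add: act_def reduced_push reduced_shift cls_letter_in_K)

lemma reduced_foldr_act: "reduced w \<Longrightarrow> p \<in> words (verts \<Gamma>) \<Longrightarrow> reduced (foldr act p w)"
  by (induction p) (auto simp: reduced_act)

lemma act_act:
  assumes "reduced w" "y \<in> verts \<Gamma>"
  shows "act (y, s) (act (y, \<not> s) w) = w"
proof -
  have "cls [(y, s)] \<cdot> cls [(y, \<not> s)] = \<one>\<^bsub>pc_group \<Gamma>\<^esub>"
    using assms inv_cls_letter[of y s] by (metis cls_closed r_inv words_Cons words_Nil)
  then show ?thesis
    using assms push_push[of w "\<not> s"] by (auto simp: act_def shift_shift shift_one)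
qed

text \<open>If one end point is \<open>x\<close>, the letter of the other lies in \<open>L\<close>
  and \<open>shift_push\<close> applies; otherwise both letters act by shifts and commute in the
  group.\<close>

lemma act_commute:
  assumes "reduced w" "{y, z} \<in> edges \<Gamma>"
  shows "act (y, s) (act (z, t) w) = act (z, t) (act (y, s) w)"
proof -
  have yz: "y \<in> verts \<Gamma>" "z \<in> verts \<Gamma>" "y \<noteq> z" "{z, y} \<in> edges \<Gamma>"
    using edge_verts[OF assms(2)] assms(2) by (auto simp: insert_commute)
  consider "y = x" | "z = x" | "y \<noteq> x" "z \<noteq> x" by blast
  then show ?thesis
  proof cases
    case 1
    then show ?thesis
      using assms yz shift_push[OF assms(1) cls_letter_in_L] by (simp add: act_def)
  next
    case 2
    then show ?thesis
      using assms yz shift_push[OF assms(1) cls_letter_in_L] by (simp add: act_def)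
  next
    case 3
    have "cls [(y, s)] \<cdot> cls [(z, t)] = cls [(z, t)] \<cdot> cls [(y, s)]"
    proof -
      have 1: "cls [(y, s)] \<cdot> gen z = gen z \<cdot> cls [(y, s)]"
        using gen_commute[OF assms(2)] commute_inv[of "gen y" "gen z"] yz
        by (cases s) (simp_all add: cls_letter_False gen_eq_cls[symmetric])
      then show ?thesis
        using commute_inv[of "gen z" "cls [(y, s)]"] yz
        by (cases t) (simp_all add: cls_letter_False gen_eq_cls[symmetric])
    qed
    then show ?thesis
      using 3 assms yz by (simp add: act_def shift_shift)
  qed
qed

text \<open>Cancelling pairs and commutator relators act trivially on reduced states, so the state
  \<open>foldr act p []\<close> depends only on the group element \<open>cls p\<close>.\<close>

lemma foldr_act_cong:
  assumes "word_equiv (verts \<Gamma>) (commutation_relators \<Gamma>) u v" "reduced w"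
  shows "foldr act u w = foldr act v w"
  using assms
proof induction
  case (cancel u v y s)
  then show ?case
    by (simp add: act_act reduced_foldr_act)
next
  case (relator u v r)
  obtain y z where r: "r = [(y, False), (z, False), (y, True), (z, True)]" "{y, z} \<in> edges \<Gamma>"
    using relator.hyps by (auto simp: commutation_relators_def)
  have yz: "y \<in> verts \<Gamma>" "z \<in> verts \<Gamma>"
    using edge_verts[OF r(2)] by auto
  have w: "reduced (foldr act v w)"
    using relator by (simp add: reduced_foldr_act)
  have "foldr act r (foldr act v w) =
      act (y, False) (act (z, False) (act (z, True) (act (y, True) (foldr act v w))))"
    using r act_commute[OF w r(2)] by simp
  also have "\<dots> = foldr act v w"
    using act_act[of _ _ False] yz w by (simp add: reduced_act)
  finally show ?case by simp
qed auto

text \<open>The coset \<open>k L\<close> determines \<open>k x\<^sup>\<plusminus>\<^sup>1 k\<^sup>-\<^sup>1\<close>, so a state represents a unique group element.\<close>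

fun represents :: "'a state \<Rightarrow> 'a word set \<Rightarrow> bool" where
  "represents [] g \<longleftrightarrow> g = \<one>\<^bsub>pc_group \<Gamma>\<^esub>"
| "represents ((C, s) # w) g \<longleftrightarrow>
     (\<exists>k \<in> K. \<exists>h. C = k \<bullet> L \<and> represents w h \<and> g = k \<cdot> cls [(x, s)] \<cdot> inv_pc k \<cdot> h)"

lemma represents_closed: "represents w g \<Longrightarrow> g \<in> carrier_pc"
  by (induction w g rule: represents.induct) (auto simp: K_closed)

text \<open>Conjugation by \<open>a\<close> works factor by factor and turns the conjugator
  \<open>k\<close> of each factor into \<open>a k\<close>.\<close>

lemma represents_shift:
  assumes "represents w g" "a \<in> K"
  shows "represents (shift a w) (a \<cdot> g \<cdot> inv_pc a)"
  using assms(1)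
proof (induction w g rule: represents.induct)
  case (1 g)
  then show ?case using K_closed[OF assms(2)] by (simp add: shift_def)
next
  case (2 C s w g)
  then obtain k h where kh: "k \<in> K" "C = k \<bullet> L" "represents w h"
    "g = k \<cdot> cls [(x, s)] \<cdot> inv_pc k \<cdot> h"
    by auto
  have c: "a \<in> carrier_pc" "k \<in> carrier_pc" "h \<in> carrier_pc"
    using assms(2) kh K_closed represents_closed by auto
  have "represents (shift a w) (a \<cdot> h \<cdot> inv_pc a)"
    using 2 kh by blast
  moreover have "a \<bullet> C = (a \<cdot> k) \<bullet> L"
    using kh c by (simp add: lcoset_lcoset)
  moreover have "a \<cdot> k \<in> K"
    using subgroup.m_closed[OF K_subgroup assms(2) kh(1)] .
  moreover have "inv_pc a \<cdot> (a \<cdot> (h \<cdot> inv_pc a)) = h \<cdot> inv_pc a"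
    using c by (simp add: m_assoc[symmetric])
  then have "a \<cdot> g \<cdot> inv_pc a = (a \<cdot> k) \<cdot> cls [(x, s)] \<cdot> inv_pc (a \<cdot> k) \<cdot> (a \<cdot> h \<cdot> inv_pc a)"
    using c kh(4) by (simp add: m_assoc inv_mult_group)
  ultimately show ?case
    unfolding shift_def by auto
qed

lemma represents_push:
  assumes "represents w g"
  shows "represents (push s w) (cls [(x, s)] \<cdot> g)"
proof (cases "w \<noteq> [] \<and> hd w = (L, \<not> s)")
  case True
  then obtain w' where w: "w = (L, \<not> s) # w'" by (cases w) auto
  then obtain k h where kh: "k \<in> K" "L = k \<bullet> L" "represents w' h"
    "g = k \<cdot> cls [(x, \<not> s)] \<cdot> inv_pc k \<cdot> h"
    using assms by auto
  have c: "k \<in> carrier_pc" "h \<in> carrier_pc"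
    using kh K_closed represents_closed by auto
  \<comment> \<open>The representative \<open>k\<close> of the deleted letter need not be trivial,
    but it lies in \<open>L\<close> and so commutes with \<open>x\<close>: the letter contributes
    just \<open>x\<close> or its inverse.\<close>
  have "k \<in> L"
    using kh(2) lcoset_L_self_iff[OF c(1)] by simp
  then have "g = cls [(x, \<not> s)] \<cdot> k \<cdot> inv_pc k \<cdot> h"
    using kh(4) L_commute by simp
  then have "g = inv_pc (cls [(x, s)]) \<cdot> h"
    using c by (simp add: m_assoc inv_cls_letter)
  then have "cls [(x, s)] \<cdot> g = h"
    using c by (simp add: m_assoc[symmetric])
  then show ?thesis using w kh(3) by (simp add: push_def)
next
  case False
  have "\<one>\<^bsub>pc_group \<Gamma>\<^esub> \<in> K" "L = \<one>\<^bsub>pc_group \<Gamma>\<^esub> \<bullet> L"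
    using subgroup.one_closed[OF K_subgroup] subgroup.one_closed[OF L_subgroup] lcoset_L_self
    by auto
  then have "represents ((L, s) # w) (cls [(x, s)] \<cdot> g)"
    using assms represents_closed[OF assms] by force
  then show ?thesis using False by (auto simp: push_def)
qed

text \<open>The semidirect decomposition: the state of \<open>p\<close> spells a product
  \<open>g\<close> of \<open>K\<close>-conjugates of \<open>x\<close> and its inverse, and the rest
  of \<open>cls p\<close> lies in \<open>K\<close>. In particular, an empty state forces
  \<open>cls p \<in> K\<close>.\<close>

lemma represents_foldr_act:
  "p \<in> words (verts \<Gamma>) \<Longrightarrow> \<exists>g. \<exists>k \<in> K. represents (foldr act p []) g \<and> cls p = g \<cdot> k"
proof (induction p)
  case Nil
  then show ?case
    using subgroup.one_closed[OF K_subgroup] by (auto simp: one_eq_cls[symmetric] intro!: bexI)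
next
  case (Cons a p)
  obtain y s where a: "a = (y, s)" by (cases a)
  have y: "y \<in> verts \<Gamma>" "p \<in> words (verts \<Gamma>)" using Cons.prems a by auto
  obtain g k where gk: "k \<in> K" "represents (foldr act p []) g" "cls p = g \<cdot> k"
    using Cons.IH y by blast
  have c: "g \<in> carrier_pc" "k \<in> carrier_pc"
    using gk K_closed represents_closed by auto
  have e: "cls (a # p) = cls [(y, s)] \<cdot> g \<cdot> k"
    using gk y a c by (simp add: cls_Cons[of y p] m_assoc)
  show ?case
  proof (cases "y = x")
    case True
    then show ?thesis
      using represents_push[OF gk(2)] a e gk(1) by (auto simp: act_def)
  next
    case False
    let ?l = "cls [(y, s)]"
    have l: "?l \<in> K" using cls_letter_in_K y False by simp
    \<comment> \<open>Moving \<open>?l\<close> past \<open>g\<close> conjugates \<open>g\<close>,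
      which shifts the state; \<open>?l\<close> is then absorbed into the factor from
      \<open>K\<close>.\<close>
    have "cls (a # p) = (?l \<cdot> g \<cdot> inv_pc ?l) \<cdot> (?l \<cdot> k)"
      using e c y m_assoc[of "inv_pc ?l" ?l k, symmetric] by (simp add: m_assoc)
    moreover have "?l \<cdot> k \<in> K"
      using subgroup.m_closed[OF K_subgroup l gk(1)] .
    ultimately show ?thesis
      using represents_shift[OF gk(2) l] False a by (auto simp: act_def)
  qed
qed

section \<open>Adjacency in the tree of reduced words and the centralizer of
  \<open>x\<close>\<close>

definition adjacent :: "'a state \<Rightarrow> 'a state \<Rightarrow> bool" where
  "adjacent u v \<longleftrightarrow> (\<exists>a. v = u @ [a] \<or> u = v @ [a])"

text \<open>\<open>push\<close> works at the head, while the two words differ at the tail. These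
  meet only if one word is empty, and then the results still differ by one letter.\<close>

lemma adjacent_push: "adjacent u v \<Longrightarrow> adjacent (push s u) (push s v)"
  by (cases u; cases v) (auto simp: adjacent_def push_def)

lemma adjacent_shift: "adjacent u v \<Longrightarrow> adjacent (shift k u) (shift k v)"
  by (auto simp: adjacent_def shift_def)

lemma adjacent_foldr_act: "adjacent u v \<Longrightarrow> adjacent (foldr act p u) (foldr act p v)"
  by (induction p) (auto simp: act_def adjacent_push adjacent_shift)

lemma shift_Nil [simp]: "shift k [] = []"
  by (simp add: shift_def)

text \<open>Letting both sides of \<open>x k = k x\<close> act on the empty state gives the
  one-letter words on \<open>L\<close> and on \<open>k L\<close>, so these cosets agree.\<close>

lemma K_commute:
  assumes "k \<in> K" "gen x \<cdot> k = k \<cdot> gen x"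
  shows "k \<in> L"
proof -
  obtain p where p: "p \<in> words (verts \<Gamma> - {x})" "k = cls p"
    using assms(1) by (auto simp: K_def span_def)
  then have pV: "p \<in> words (verts \<Gamma>)"
    using words_mono[of "verts \<Gamma> - {x}" "verts \<Gamma>"] by auto
  have shift: "foldr act q w = shift (cls q) w" if "q \<in> words (verts \<Gamma> - {x})" "reduced w" for q w
    using that(1)
  proof (induction q)
    case Nil
    then show ?case using that(2) by (simp add: one_eq_cls[symmetric] shift_one)
  next
    case (Cons a q)
    obtain y s where a: "a = (y, s)" by (cases a)
    have "y \<in> verts \<Gamma>" "y \<noteq> x" "q \<in> words (verts \<Gamma> - {x})" "q \<in> words (verts \<Gamma>)"
      using Cons.prems a words_mono[of "verts \<Gamma> - {x}" "verts \<Gamma>"] by auto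
    then show ?case
      using Cons.IH a that(2) by (simp add: act_def shift_shift cls_Cons[of y q])
  qed
  have r: "reduced [(L, True)]"
    using reduced_push[of "[]" True] by (simp add: push_def)
  have "cls ((x, True) # p) = cls (p @ [(x, True)])"
    using assms(2) p(2) pV by (simp add: cls_Cons[of x p] cls_append gen_eq_cls[symmetric])
  then have "foldr act ((x, True) # p) [] = foldr act (p @ [(x, True)]) []"
    using pV by (intro foldr_act_cong) (simp_all add: word_class_eq_iff)
  then have "[(L, True)] = [(k \<bullet> L, True)]"
    using p shift[OF p(1)] r by (simp add: act_def push_def) (simp add: shift_def)
  then show ?thesis
    using lcoset_L_self_iff[OF K_closed[OF assms(1)]] by simp
qed

text \<open>The images of \<open>g\<close> and \<open>g x = x g\<close> in the tree of reduced words are adjacent. If the first is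
  a nonempty word \<open>w\<close> not starting with \<open>x\<^sup>\<plusminus>\<^sup>1\<close>, the second is \<open>x w\<close>, which is not adjacent
  to \<open>w\<close>.\<close>

theorem centralizer_gen:
  assumes "g \<in> carrier_pc" "gen x \<cdot> g = g \<cdot> gen x"
  shows "g \<in> span (insert x (link x))"
proof -
  let ?S = "span (insert x (link x))"
  have SV: "insert x (link x) \<subseteq> verts \<Gamma>" using link_verts by auto
  have "cls p \<in> ?S" if "p \<in> words (verts \<Gamma>)" "gen x \<cdot> cls p = cls p \<cdot> gen x" for p
    using that
  proof (induction "length (foldr act p [])" arbitrary: p rule: less_induct)
    case less
    let ?w = "foldr act p []"
    show ?case
    proof (cases "?w = []")
      case True
      then have "cls p \<in> K"
        using represents_foldr_act[OF less.prems(1)] K_closed by auto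
      then have "cls p \<in> L"
        using K_commute less.prems(2) by simp
      then show ?thesis
        unfolding L_def using span_mono[of "link x" "insert x (link x)"] by auto
    next
      case False
      have "\<exists>s. hd ?w = (L, s)"
      proof (rule ccontr)
        assume *: "\<not> ?thesis"
        have "cls ((x, True) # p) = cls (p @ [(x, True)])"
          using less.prems by (simp add: cls_Cons[of x p] cls_append gen_eq_cls[symmetric])
        then have "foldr act ((x, True) # p) [] = foldr act (p @ [(x, True)]) []"
          using less.prems by (intro foldr_act_cong) (simp_all add: word_class_eq_iff)
        then have "push True ?w = foldr act p [(L, True)]"
          by (simp add: act_def push_def)
        moreover have "push True ?w = (L, True) # ?w"
          using * unfolding push_def by auto
        moreover have "adjacent ?w (foldr act p [(L, True)])"
          by (rule adjacent_foldr_act) (simp only: adjacent_def append_Nil, blast)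
        \<comment> \<open>The other alternative of adjacency fails by length. In this one the
          nonempty \<open>?w\<close> must have head \<open>(L, True)\<close>, contrary to
          assumption.\<close>
        ultimately obtain a where "(L, True) # ?w = ?w @ [a]"
          unfolding adjacent_def by auto
        then show False
          using * False by (metis hd_append2 list.sel(1))
      qed
      then obtain s w' where w: "?w = (L, s) # w'"
        using False by (cases ?w) auto
      \<comment> \<open>Prepending this letter deletes the head of the state and preserves
        commutation with \<open>x\<close>, so the induction hypothesis applies.\<close>
      let ?p = "(x, \<not> s) # p"
      let ?l = "cls [(x, \<not> s)]"
      have p: "cls ?p = ?l \<cdot> cls p"
        using less.prems by (simp add: cls_Cons[of x p])
      have l: "gen x \<cdot> ?l = ?l \<cdot> gen x"
        by (cases s) (simp_all add: cls_letter_False gen_eq_cls[symmetric])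
      have "gen x \<cdot> cls ?p = (gen x \<cdot> ?l) \<cdot> cls p"
        using p less.prems by (simp add: m_assoc)
      also have "\<dots> = ?l \<cdot> (gen x \<cdot> cls p)"
        unfolding l using less.prems by (simp add: m_assoc)
      also have "\<dots> = cls ?p \<cdot> gen x"
        unfolding less.prems(2) using p less.prems by (simp add: m_assoc)
      finally have c: "gen x \<cdot> cls ?p = cls ?p \<cdot> gen x" .
      have "foldr act ?p [] = w'"
        using w by (simp add: act_def push_def)
      then have "cls ?p \<in> ?S"
        using c w less.prems by (intro less.hyps) simp_all
      moreover have "cls p = cls [(x, s)] \<cdot> cls ?p"
        using p less.prems inv_cls_letter[of x s] m_assoc[of "cls [(x, s)]" ?l "cls p", symmetric]
        by (metis cls_closed inv_closed l_one r_inv words_Cons words_Nil x)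
      ultimately show ?thesis
        using span_mult[OF SV gen_in_span[of x]] by simp
    qed
  qed
  then show ?thesis
    using assms by (auto simp: carrier_eq_span span_def)
qed

end

section \<open>Edges of the extension graph\<close>

context pc_graph
begin

lemma centralizer:
  assumes "x \<in> verts \<Gamma>" "g \<in> carrier_pc" "gen x \<cdot> g = g \<cdot> gen x"
  shows "g \<in> span (insert x (link x))"
proof -
  interpret pc_vertex \<Gamma> x
    by unfold_locales fact
  show ?thesis
    using assms(2,3) by (rule centralizer_gen)
qed

section \<open>Conjugation and commuting conjugates of generators\<close>

definition cj :: "'a word set \<Rightarrow> 'a word set \<Rightarrow> 'a word set" where
  "cj g a = inv_pc g \<cdot> a \<cdot> g"

lemma cj_closed [simp]: "g \<in> carrier_pc \<Longrightarrow> a \<in> carrier_pc \<Longrightarrow> cj g a \<in> carrier_pc"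
  by (simp add: cj_def)

lemma cj_cj:
  "g \<in> carrier_pc \<Longrightarrow> h \<in> carrier_pc \<Longrightarrow> a \<in> carrier_pc \<Longrightarrow> cj h (cj g a) = cj (g \<cdot> h) a"
  by (simp add: cj_def inv_mult_group m_assoc)

lemma cj_mult:
  assumes "g \<in> carrier_pc" "a \<in> carrier_pc" "b \<in> carrier_pc"
  shows "cj g a \<cdot> cj g b = cj g (a \<cdot> b)"
proof -
  have "g \<cdot> (inv_pc g \<cdot> (b \<cdot> g)) = b \<cdot> g"
    using assms by (simp add: m_assoc[symmetric])
  then show ?thesis
    using assms by (simp add: cj_def m_assoc)
qed

lemma cj_inject:
  "g \<in> carrier_pc \<Longrightarrow> a \<in> carrier_pc \<Longrightarrow> b \<in> carrier_pc \<Longrightarrow> cj g a = cj g b \<longleftrightarrow> a = b"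
  by (simp add: cj_def)

lemma cj_fixed: "g \<in> carrier_pc \<Longrightarrow> a \<in> carrier_pc \<Longrightarrow> g \<cdot> a = a \<cdot> g \<Longrightarrow> cj g a = a"
  using commute_inv[of g a] by (simp add: cj_def m_assoc)

lemma cj_commute_iff:
  assumes "g \<in> carrier_pc" "a \<in> carrier_pc" "b \<in> carrier_pc"
  shows "cj g a \<cdot> cj g b = cj g b \<cdot> cj g a \<longleftrightarrow> a \<cdot> b = b \<cdot> a"
  using assms by (simp add: cj_mult cj_inject)

text \<open>The converse of \<open>centralizer\<close>, stated for subsets of the star so that it
  also applies to a smaller star of another vertex.\<close>

lemma span_star_commute:
  assumes "x \<in> verts \<Gamma>" "S \<subseteq> insert x (link x)" "g \<in> span S"
  shows "g \<cdot> gen x = gen x \<cdot> g"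
proof (rule commute_span[OF _ _ _ assms(3)])
  show "S \<subseteq> verts \<Gamma>" using assms(1,2) link_verts by blast
  show "gen y \<cdot> gen x = gen x \<cdot> gen y" if "y \<in> S" for y
    using that assms(2) gen_commute[of x y] by (auto simp: link_def)
qed (use assms in simp)

text \<open>After conjugating the first element to \<open>x\<close>, the retraction onto the centralizer of \<open>x\<close> fixes
  the second one, so it moves the conjugating element into that centralizer.\<close>

lemma commuting_conjugates:
  assumes x: "x \<in> verts \<Gamma>" and y: "y \<in> verts \<Gamma>"
    and g: "g \<in> carrier_pc" and h: "h \<in> carrier_pc"
    and comm: "cj g (gen x) \<cdot> cj h (gen y) = cj h (gen y) \<cdot> cj g (gen x)"
    and neq: "cj g (gen x) \<noteq> cj h (gen y)"
  shows "{x, y} \<in> edges \<Gamma>"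
    and "\<exists>k \<in> carrier_pc. cj g (gen x) = cj k (gen x) \<and> cj h (gen y) = cj k (gen y)"
proof -
  let ?S = "insert x (link x)"
  have S: "?S \<subseteq> verts \<Gamma>" using x link_verts by auto
  \<comment> \<open>Conjugating both elements by the inverse of \<open>g\<close> turns the pair into
    \<open>gen x\<close> and \<open>?v\<close>.\<close>
  define m where "m = h \<cdot> inv_pc g"
  have m: "m \<in> carrier_pc" using g h by (simp add: m_def)
  have hm: "h = m \<cdot> g" using g h by (simp add: m_def m_assoc)
  let ?v = "cj m (gen y)"
  have v: "cj h (gen y) = cj g ?v"
    using hm g m y by (simp add: cj_cj)
  have "gen x \<cdot> ?v = ?v \<cdot> gen x"
    using comm x y g m by (simp add: v cj_commute_iff)
  then have "?v \<in> span ?S"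
    using x y m by (intro centralizer) auto
  then have fixed: "retract ?S ?v = ?v"
    by (rule retract_eq[OF S])
  interpret R: group_hom "pc_group \<Gamma>" "pc_group \<Gamma>" "retract ?S"
    using retract_hom by unfold_locales
  define r where "r = retract ?S m"
  have r: "r \<in> carrier_pc" "r \<in> span ?S"
    using m retract_in_span[OF m, of ?S] S by (auto simp: r_def Int_absorb1)
  have v': "?v = cj r (retract ?S (gen y))"
    using fixed m y by (simp add: cj_def r_def)
  \<comment> \<open>Otherwise the retraction kills \<open>gen y\<close> and hence \<open>?v\<close>,
    although a conjugate of a generator is nontrivial.\<close>
  have "y \<in> ?S"
  proof (rule ccontr)
    assume "y \<notin> ?S"
    then have "?v = \<one>\<^bsub>pc_group \<Gamma>\<^esub>"
      using v' y r by (simp add: retract_gen cj_def)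
    then have "cj m (gen y) = cj m \<one>\<^bsub>pc_group \<Gamma>\<^esub>"
      using m by (simp add: cj_def)
    then show False
      using cj_inject[OF m] y gen_neq_one by simp
  qed
  then have v'': "?v = cj r (gen y)"
    using v' y by (simp add: retract_gen)
  \<comment> \<open>Since \<open>r\<close> commutes with \<open>x\<close>, it can be put in front of
    \<open>g\<close> without changing the first conjugate; this makes \<open>r \<cdot> g\<close> a
    common conjugator.\<close>
  have rx: "cj r (gen x) = gen x"
    using r x span_star_commute[OF x] by (intro cj_fixed) auto
  have "y \<noteq> x"
    using neq rx v v'' by auto
  then show "{x, y} \<in> edges \<Gamma>"
    using \<open>y \<in> ?S\<close> by (simp add: link_def)
  show "\<exists>k \<in> carrier_pc. cj g (gen x) = cj k (gen x) \<and> cj h (gen y) = cj k (gen y)"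
  proof (rule bexI[of _ "r \<cdot> g"])
    show "cj g (gen x) = cj (r \<cdot> g) (gen x) \<and> cj h (gen y) = cj (r \<cdot> g) (gen y)"
      using rx v v'' r g x y by (simp add: cj_cj[symmetric])
  qed (use r g in simp)
qed

text \<open>Once \<open>k\<close> is undone, \<open>w\<close> centralizes \<open>gen x\<close> and
  so lies in the star subgroup of \<open>x\<close>, whose generators all commute with
  \<open>gen y\<close> by the inclusion of stars.\<close>

lemma commute_conjugate_mono:
  assumes "x \<in> verts \<Gamma>" "y \<in> verts \<Gamma>" "insert x (link x) \<subseteq> insert y (link y)"
    and "k \<in> carrier_pc" "w \<in> carrier_pc" "cj k (gen x) \<cdot> w = w \<cdot> cj k (gen x)"
  shows "cj k (gen y) \<cdot> w = w \<cdot> cj k (gen y)"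
proof -
  define w' where "w' = cj (inv_pc k) w"
  have w': "w' \<in> carrier_pc" "w = cj k w'"
    using assms(4,5) by (simp_all add: w'_def cj_cj) (simp add: cj_def)
  have "gen x \<cdot> w' = w' \<cdot> gen x"
    using assms w' by (simp add: cj_commute_iff)
  then have "w' \<in> span (insert x (link x))"
    using assms(1) w' by (intro centralizer) auto
  then have "w' \<cdot> gen y = gen y \<cdot> w'"
    using span_star_commute[OF assms(2,3)] by blast
  then show ?thesis
    using assms w' by (simp add: cj_commute_iff)
qed

section \<open>Vertices, edges and induced subgraphs of the extension graph\<close>

lemma extension_graph_vertsE:
  assumes "u \<in> verts (extension_graph \<Gamma>)"
  obtains x g where "x \<in> verts \<Gamma>" "g \<in> carrier_pc" "u = cj g (gen x)"
  using assms by (auto simp: extension_graph_def Let_def cj_def)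

lemma extension_graph_edge_iff:
  assumes "u \<in> verts (extension_graph \<Gamma>)" "v \<in> verts (extension_graph \<Gamma>)"
  shows "{u, v} \<in> edges (extension_graph \<Gamma>) \<longleftrightarrow> u \<noteq> v \<and> u \<cdot> v = v \<cdot> u"
proof -
  have c: "w \<in> carrier_pc" if "w \<in> verts (extension_graph \<Gamma>)" for w
    using that by (rule extension_graph_vertsE) simp
  have "{u, v} \<in> edges (extension_graph \<Gamma>) \<longleftrightarrow>
      (\<exists>a b. {u, v} = {a, b} \<and> a \<in> verts (extension_graph \<Gamma>) \<and> b \<in> verts (extension_graph \<Gamma>) \<and>
        a \<noteq> b \<and> commutator (pc_group \<Gamma>) a b = \<one>\<^bsub>pc_group \<Gamma>\<^esub>)"
    by (simp add: extension_graph_def Let_def)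
  also have "\<dots> \<longleftrightarrow> u \<noteq> v \<and> u \<cdot> v = v \<cdot> u"
  proof
    assume "u \<noteq> v \<and> u \<cdot> v = v \<cdot> u"
    then show "\<exists>a b. {u, v} = {a, b} \<and> a \<in> verts (extension_graph \<Gamma>) \<and>
        b \<in> verts (extension_graph \<Gamma>) \<and> a \<noteq> b \<and> commutator (pc_group \<Gamma>) a b = \<one>\<^bsub>pc_group \<Gamma>\<^esub>"
      using assms c by (intro exI[of _ u] exI[of _ v]) (simp add: commutator_eq_one_iff)
  qed (use c in \<open>auto simp: commutator_eq_one_iff doubleton_eq_iff\<close>)
  finally show ?thesis .
qed

text \<open>\<open>t\<close> sends a vertex to a generator of which its image is a conjugate. An
  inclusion of stars would make everything commuting with the image of \<open>p\<close> commute with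
  that of \<open>q\<close>; a neighbour \<open>r\<close> of \<open>p\<close> not adjacent to
  \<open>q\<close> refutes this.\<close>

lemma induced_subgraph_extension_graphE:
  fixes \<Lambda> :: "'b sgraph"
  assumes "is_induced_subgraph \<Lambda> (extension_graph \<Gamma>)" "simple_graph \<Lambda>"
  obtains t where "\<And>p q. {p, q} \<in> edges \<Lambda> \<Longrightarrow> {t p, t q} \<in> edges \<Gamma>"
    and "\<And>p q r. {p, q} \<in> edges \<Lambda> \<Longrightarrow> {p, r} \<in> edges \<Lambda> \<Longrightarrow> {q, r} \<notin> edges \<Lambda> \<Longrightarrow> q \<noteq> r \<Longrightarrow>
      \<not> insert (t p) (link (t p)) \<subseteq> insert (t q) (link (t q))"
proof -
  let ?E = "extension_graph \<Gamma>"
  obtain S f where S: "S \<subseteq> verts ?E" and f: "bij_betw f (verts \<Lambda>) S"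
    and edge: "\<And>p q. p \<in> verts \<Lambda> \<Longrightarrow> q \<in> verts \<Lambda> \<Longrightarrow>
      {p, q} \<in> edges \<Lambda> \<longleftrightarrow> {f p, f q} \<in> {E \<in> edges ?E. E \<subseteq> S}"
    using assms(1) unfolding is_induced_subgraph_def graph_iso_def full_subgraph_def by auto
  have fv: "f p \<in> S" "f p \<in> verts ?E" if "p \<in> verts \<Lambda>" for p
    using that f S bij_betwE by blast+
  have edge_iff: "{p, q} \<in> edges \<Lambda> \<longleftrightarrow> f p \<cdot> f q = f q \<cdot> f p"
    if "p \<in> verts \<Lambda>" "q \<in> verts \<Lambda>" "p \<noteq> q" for p q
    using that edge[OF that(1,2)] fv extension_graph_edge_iff[of "f p" "f q"] f
    by (auto simp: bij_betw_def inj_on_eq_iff)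
  have "\<forall>p \<in> verts \<Lambda>. \<exists>x g. x \<in> verts \<Gamma> \<and> g \<in> carrier_pc \<and> f p = cj g (gen x)"
    using fv(2) extension_graph_vertsE by metis
  then obtain t c where tc: "\<And>p. p \<in> verts \<Lambda> \<Longrightarrow>
      t p \<in> verts \<Gamma> \<and> c p \<in> carrier_pc \<and> f p = cj (c p) (gen (t p))"
    by metis
  have v: "p \<in> verts \<Lambda>" "q \<in> verts \<Lambda>" "p \<noteq> q" if "{p, q} \<in> edges \<Lambda>" for p q
    using pc_graph.edge_verts[OF pc_graph.intro[OF assms(2)] that] by auto
  have conj: "{t p, t q} \<in> edges \<Gamma>"
    "\<exists>k \<in> carrier_pc. f p = cj k (gen (t p)) \<and> f q = cj k (gen (t q))"
    if "{p, q} \<in> edges \<Lambda>" for p q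
  proof -
    have "f p \<noteq> f q" "f p \<cdot> f q = f q \<cdot> f p"
      using that v[OF that] f edge_iff by (auto simp: bij_betw_def inj_on_eq_iff)
    then show "{t p, t q} \<in> edges \<Gamma>"
      "\<exists>k \<in> carrier_pc. f p = cj k (gen (t p)) \<and> f q = cj k (gen (t q))"
      using commuting_conjugates[of "t p" "t q" "c p" "c q"] tc[OF v(1)[OF that]] tc[OF v(2)[OF that]]
      by auto
  qed
  have "\<not> insert (t p) (link (t p)) \<subseteq> insert (t q) (link (t q))"
    if pq: "{p, q} \<in> edges \<Lambda>" and pr: "{p, r} \<in> edges \<Lambda>"
      and qr: "{q, r} \<notin> edges \<Lambda>" "q \<noteq> r" for p q r
  proof
    assume star: "insert (t p) (link (t p)) \<subseteq> insert (t q) (link (t q))"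
    obtain k where k: "k \<in> carrier_pc" "f p = cj k (gen (t p))" "f q = cj k (gen (t q))"
      using conj(2)[OF pq] by blast
    have "f p \<cdot> f r = f r \<cdot> f p"
      using pr v[OF pr] edge_iff by blast
    then have "f q \<cdot> f r = f r \<cdot> f q"
      using commute_conjugate_mono[OF _ _ star k(1), of "f r"] tc[OF v(1)[OF pq]]
        tc[OF v(2)[OF pq]] tc[OF v(2)[OF pr]] k by auto
    then show False
      using qr v[OF pr] v[OF pq] edge_iff by blast
  qed
  with conj(1) show thesis
    by (rule that)
qed

end

section \<open>Triangles and twins in \<open>Gamma2\<close>\<close>

lemma Gamma2_neighbours:
  "{z. {va, z} \<in> edges Gamma2} = {}"
  "{z. {va1, z} \<in> edges Gamma2} = {va2, vc, vd, ve}"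
  "{z. {va2, z} \<in> edges Gamma2} = {va1, vb, vd, ve}"
  "{z. {vb, z} \<in> edges Gamma2} = {va2, ve}"
  "{z. {vc, z} \<in> edges Gamma2} = {va1, vd}"
  "{z. {vd, z} \<in> edges Gamma2} = {va1, va2, vc, ve}"
  "{z. {ve, z} \<in> edges Gamma2} = {va1, va2, vb, vd}"
  by (auto simp: Gamma2_def doubleton_eq_iff)

lemma doubleton_subset_triple:
  assumes "a \<noteq> b" "{a, b} \<subseteq> {x, y, z}"
  shows "{a, b} \<in> {{x, y}, {x, z}, {y, z}}"
proof -
  have "a = x \<or> a = y \<or> a = z" "b = x \<or> b = y \<or> b = z"
    using assms(2) by auto
  then show ?thesis
    using assms(1) by (elim disjE) (simp_all add: insert_commute)
qed

text \<open>Three vertices of the clique \<open>va1\<close>, \<open>va2\<close>, \<open>vd\<close>,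
  \<open>ve\<close> include one of the two pairs by pigeonhole. The only other triangles are
  \<open>va1\<close>, \<open>vc\<close>, \<open>vd\<close> and \<open>va2\<close>,
  \<open>vb\<close>, \<open>ve\<close>.\<close>

lemma Gamma2_triangle:
  assumes "{x, y} \<in> edges Gamma2" "{x, z} \<in> edges Gamma2" "{y, z} \<in> edges Gamma2"
  shows "\<not> {{x, y}, {x, z}, {y, z}} \<inter> {{va1, vd}, {va2, ve}} = {}"
proof -
  have "y \<in> {z. {x, z} \<in> edges Gamma2}" "z \<in> {z. {x, z} \<in> edges Gamma2}"
    "z \<in> {z. {y, z} \<in> edges Gamma2}"
    using assms by auto
  \<comment> \<open>The case split runs over the whole datatype, including \<open>va\<close>, which
    is no vertex of \<open>Gamma2\<close> and has an empty neighbourhood.\<close>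
  then have "{va1, vd} \<subseteq> {x, y, z} \<or> {va2, ve} \<subseteq> {x, y, z}"
    by (cases x; cases y; simp only: Gamma2_neighbours) auto
  moreover have "va1 \<noteq> vd" "va2 \<noteq> ve"
    by simp_all
  ultimately show ?thesis
    using doubleton_subset_triple[of _ _ x y z] by (metis IntI empty_iff insertI1 insertI2)
qed

lemma Gamma2_twins:
  assumes "{x, y} \<in> {{va1, vd}, {va2, ve}}"
  shows "insert x {z. {x, z} \<in> edges Gamma2} = insert y {z. {y, z} \<in> edges Gamma2}"
proof -
  have "x = va1 \<and> y = vd \<or> x = vd \<and> y = va1 \<or> x = va2 \<and> y = ve \<or> x = ve \<and> y = va2"
    using assms by (auto simp: doubleton_eq_iff)
  then show ?thesis
    by (elim disjE conjE; hypsubst; simp only: Gamma2_neighbours) blast+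
qed

theorem lemma3p2:
  shows "\<not> is_induced_subgraph Gamma1 (extension_graph Gamma2)"
proof
  interpret pc_graph Gamma2
    by unfold_locales (rule simple_graph_Gamma2)
  assume "is_induced_subgraph Gamma1 (extension_graph Gamma2)"
  then obtain t where adj: "\<And>p q. {p, q} \<in> edges Gamma1 \<Longrightarrow> {t p, t q} \<in> edges Gamma2"
    and sep: "\<And>p q r. {p, q} \<in> edges Gamma1 \<Longrightarrow> {p, r} \<in> edges Gamma1 \<Longrightarrow>
      {q, r} \<notin> edges Gamma1 \<Longrightarrow> q \<noteq> r \<Longrightarrow>
      \<not> insert (t p) (link (t p)) \<subseteq> insert (t q) (link (t q))"
    using induced_subgraph_extension_graphE[OF _ simple_graph_Gamma1] by metis
  \<comment> \<open>Twins have equal stars, and equality gives the inclusion that \<open>sep\<close>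
    forbids.\<close>
  have separated: "{t p, t q} \<notin> {{va1, vd}, {va2, ve}}"
    if "{p, q} \<in> edges Gamma1" "{p, r} \<in> edges Gamma1" "{q, r} \<notin> edges Gamma1" "q \<noteq> r" for p q r
    using sep[OF that] equalityD1[OF Gamma2_twins[of "t p" "t q"]] unfolding link_def by metis
  have E: "{vd, ve} \<in> edges Gamma1" "{vd, va} \<in> edges Gamma1" "{ve, va} \<in> edges Gamma1"
    "{vd, vc} \<in> edges Gamma1" "{ve, vb} \<in> edges Gamma1"
    "{ve, vc} \<notin> edges Gamma1" "{va, vc} \<notin> edges Gamma1" "{va, vb} \<notin> edges Gamma1"
    by (simp_all add: Gamma1_def doubleton_eq_iff)
  \<comment> \<open>The witnesses: \<open>vc\<close> is adjacent to \<open>vd\<close> but to neither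
    \<open>ve\<close> nor \<open>va\<close>, and \<open>vb\<close> is adjacent to \<open>ve\<close>
    but not to \<open>va\<close>.\<close>
  have "{t vd, t ve} \<notin> {{va1, vd}, {va2, ve}}"
    using E by (intro separated[of vd ve vc]) simp_all
  moreover have "{t vd, t va} \<notin> {{va1, vd}, {va2, ve}}"
    using E by (intro separated[of vd va vc]) simp_all
  moreover have "{t ve, t va} \<notin> {{va1, vd}, {va2, ve}}"
    using E by (intro separated[of ve va vb]) simp_all
  moreover have "\<not> {{t vd, t ve}, {t vd, t va}, {t ve, t va}} \<inter> {{va1, vd}, {va2, ve}} = {}"
    using E adj by (intro Gamma2_triangle) simp_all
  ultimately show False
    by (simp only: Int_insert_left if_False Int_empty_left simp_thms)
qed

end
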